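(* Let $f=h+\overline{g}\in\mathcal{S}_H$, with $h(z)=z+\sum_{n=2}^{\infty}a_nz^n$ and $g(z)=\sum_{n=1}^{\infty}b_nz^n$ for $|z|<1$, and suppose that $f$ has integer coefficients, i.e. $a_n\in\mathbb{Z}$ for all $n\ge 2$ and $b_n\in\mathbb{Z}$ for all $n\ge 1$. Then $f$ is one of the nine functions in $$\mathcal{S}_{\mathbb{Z}}=\left\{z,\ \frac{z}{1+z},\ \frac{z}{1-z},\ \frac{z}{1+z^2},\ \frac{z}{1-z^2},\ \frac{z}{(1+z)^2},\ \frac{z}{(1-z)^2},\ \frac{z}{1+z+z^2},\ \frac{z}{1-z+z^2}\right\}.$$
   Context: Let $\mathbb{D}=\{z\in\mathbb{C}:|z|<1\}$. A complex-valued harmonic function on $\mathbb{D}$ is $f=u+iv$ with $u,v$ real harmonic on $\mathbb{D}$; it can be written $f=h+\overline{g}$ with $h,g$ analytic in $\mathbb{D}$. The function $f$ is univalent if it is injective on $\mathbb{D}$, and sense-preserving if its Jacobian $J_f(z)=|h'(z)|^2-|g'(z)|^2$ satisfies $J_f(z)>0$ for all $z\in\mathbb{D}$. $\mathcal{S}_H$ denotes the class of all univalent sense-preserving harmonic functions $f=h+\overline{g}$ on $\mathbb{D}$ with $h(z)=z+\sum_{n=2}^{\infty}a_nz^n$ and $g(z)=\sum_{n=1}^{\infty}b_nz^n$ for $z\in\mathbb{D}$. *)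

theory Defs
  imports "HOL-Complex_Analysis.Complex_Analysis"
begin

abbreviation unit_disc :: "complex set" ("\<D>") where
  "\<D> \<equiv> ball 0 1"

(* Twice continuously differentiable with vanishing Laplacian, for z = x + i y and open S.
   The witnesses are the partial derivatives, e.g. uxy is the y-derivative of ux. *)
definition real_harmonic_on :: "(complex \<Rightarrow> real) \<Rightarrow> complex set \<Rightarrow> bool" where
  "real_harmonic_on u S \<longleftrightarrow>
     (\<exists>ux uy uxx uxy uyx uyy :: complex \<Rightarrow> real.
        continuous_on S ux \<and> continuous_on S uy \<and>
        continuous_on S uxx \<and> continuous_on S uxy \<and>
        continuous_on S uyx \<and> continuous_on S uyy \<and>
        (\<forall>z\<in>S.
           ((\<lambda>t. u (z + of_real t)) has_real_derivative ux z) (at 0) \<and>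
           ((\<lambda>t. u (z + \<i> * of_real t)) has_real_derivative uy z) (at 0) \<and>
           ((\<lambda>t. ux (z + of_real t)) has_real_derivative uxx z) (at 0) \<and>
           ((\<lambda>t. ux (z + \<i> * of_real t)) has_real_derivative uxy z) (at 0) \<and>
           ((\<lambda>t. uy (z + of_real t)) has_real_derivative uyx z) (at 0) \<and>
           ((\<lambda>t. uy (z + \<i> * of_real t)) has_real_derivative uyy z) (at 0) \<and>
           uxx z + uyy z = 0))"

definition harmonic_on :: "(complex \<Rightarrow> complex) \<Rightarrow> complex set \<Rightarrow> bool" where
  "harmonic_on f S \<longleftrightarrow>
     real_harmonic_on (\<lambda>z. Re (f z)) S \<and> real_harmonic_on (\<lambda>z. Im (f z)) S"

definition decomposes_as ::
    "(complex \<Rightarrow> complex) \<Rightarrow> (complex \<Rightarrow> complex) \<Rightarrow> (complex \<Rightarrow> complex) \<Rightarrow> bool" where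
  "decomposes_as f h g \<longleftrightarrow>
     h holomorphic_on \<D> \<and> g holomorphic_on \<D> \<and> (\<forall>z\<in>\<D>. f z = h z + cnj (g z))"

definition jacobian :: "(complex \<Rightarrow> complex) \<Rightarrow> (complex \<Rightarrow> complex) \<Rightarrow> complex \<Rightarrow> real" where
  "jacobian h g z = (cmod (deriv h z))\<^sup>2 - (cmod (deriv g z))\<^sup>2"

(* The shifts of the summation index express the ranges n >= 2 and n >= 1;
   the values a 0, a 1 and b 0 play no role. *)
definition normalized_expansion ::
    "(complex \<Rightarrow> complex) \<Rightarrow> (complex \<Rightarrow> complex) \<Rightarrow> (nat \<Rightarrow> complex) \<Rightarrow> (nat \<Rightarrow> complex) \<Rightarrow> bool"
  where
  "normalized_expansion h g a b \<longleftrightarrow>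
     (\<forall>z\<in>\<D>. (\<lambda>n. a (n + 2) * z ^ (n + 2)) sums (h z - z) \<and>
             (\<lambda>n. b (n + 1) * z ^ (n + 1)) sums g z)"

(* Functions on the disc are represented by total functions; values off the disc are arbitrary. *)
definition S_H :: "(complex \<Rightarrow> complex) set" where
  "S_H = {f. harmonic_on f \<D> \<and> inj_on f \<D> \<and>
            (\<exists>h g a b. decomposes_as f h g \<and> normalized_expansion h g a b \<and>
                       (\<forall>z\<in>\<D>. jacobian h g z > 0))}"

definition S_Z :: "(complex \<Rightarrow> complex) set" where
  "S_Z = {\<lambda>z. z,
          \<lambda>z. z / (1 + z), \<lambda>z. z / (1 - z),
          \<lambda>z. z / (1 + z^2), \<lambda>z. z / (1 - z^2),
          \<lambda>z. z / (1 + z)^2, \<lambda>z. z / (1 - z)^2,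
          \<lambda>z. z / (1 + z + z^2), \<lambda>z. z / (1 - z + z^2)}"

lemma real_harmonic_on_Re:
  assumes "F holomorphic_on S" "open S"
  shows "real_harmonic_on (\<lambda>z. Re (F z)) S"
proof -
  have d: "((\<lambda>t. Re (c * G (z + w * of_real t))) has_real_derivative Re (c * w * deriv G z)) (at 0)"
    if "G holomorphic_on S" "z \<in> S" for G :: "complex \<Rightarrow> complex" and c z w
  proof -
    have G: "(G has_field_derivative deriv G z) (at (z + w * of_real 0))"
      using that assms(2) by (simp add: holomorphic_derivI)
    have l: "((\<lambda>t. z + w * of_real t) has_vector_derivative w) (at (0::real))"
      by (auto intro!: derivative_eq_intros)
    have "((\<lambda>t. G (z + w * of_real t)) has_vector_derivative w * deriv G z) (at (0::real))"
      using field_vector_diff_chain_at[OF l] G by (simp add: o_def)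
    then have "((\<lambda>t. c * G (z + w * of_real t)) has_vector_derivative c * (w * deriv G z)) (at (0::real))"
      by (rule has_vector_derivative_mult_right)
    then show ?thesis
      by (auto simp: has_vector_derivative_complex_iff mult.assoc)
  qed
  let ?F1 = "deriv F" and ?F2 = "deriv (deriv F)"
  have h1: "?F1 holomorphic_on S" and h2: "?F2 holomorphic_on S"
    using assms by (auto intro!: holomorphic_deriv)
  have c1: "continuous_on S ?F1" and c2: "continuous_on S ?F2"
    using h1 h2 by (auto intro: holomorphic_on_imp_continuous_on)
  show ?thesis
    unfolding real_harmonic_on_def
  proof (intro exI conjI ballI)
    show "continuous_on S (\<lambda>z. Re (?F1 z))" "continuous_on S (\<lambda>z. Re (\<i> * ?F1 z))"
      "continuous_on S (\<lambda>z. Re (?F2 z))" "continuous_on S (\<lambda>z. Re (\<i> * ?F2 z))"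
      "continuous_on S (\<lambda>z. Re (\<i> * ?F2 z))" "continuous_on S (\<lambda>z. Re (\<i> * \<i> * ?F2 z))"
      by (intro continuous_intros c1 c2)+
  next
    fix z assume z: "z \<in> S"
    show "((\<lambda>t. Re (F (z + of_real t))) has_real_derivative Re (?F1 z)) (at 0)"
      using d[OF assms(1) z, of 1 1] by simp
    show "((\<lambda>t. Re (F (z + \<i> * of_real t))) has_real_derivative Re (\<i> * ?F1 z)) (at 0)"
      using d[OF assms(1) z, of 1 \<i>] by simp
    show "((\<lambda>t. Re (?F1 (z + of_real t))) has_real_derivative Re (?F2 z)) (at 0)"
      using d[OF h1 z, of 1 1] by simp
    show "((\<lambda>t. Re (?F1 (z + \<i> * of_real t))) has_real_derivative Re (\<i> * ?F2 z)) (at 0)"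
      using d[OF h1 z, of 1 \<i>] by simp
    show "((\<lambda>t. Re (\<i> * ?F1 (z + of_real t))) has_real_derivative Re (\<i> * ?F2 z)) (at 0)"
      using d[OF h1 z, of \<i> 1] by simp
    show "((\<lambda>t. Re (\<i> * ?F1 (z + \<i> * of_real t))) has_real_derivative Re (\<i> * \<i> * ?F2 z)) (at 0)"
      using d[OF h1 z, of \<i> \<i>] by simp
    show "Re (?F2 z) + Re (\<i> * \<i> * ?F2 z) = 0"
      by simp
  qed
qed

lemma real_harmonic_on_cong:
  assumes "real_harmonic_on u S" "open S" "\<And>z. z \<in> S \<Longrightarrow> u z = v z"
  shows "real_harmonic_on v S"
proof -
  have d: "((\<lambda>t. v (z + w * of_real t)) has_real_derivative D) (at 0)"
    if "((\<lambda>t. u (z + w * of_real t)) has_real_derivative D) (at 0)" "z \<in> S" for z w D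
  proof (rule DERIV_cong_ev[THEN iffD1, OF refl _ refl that(1)])
    have "((\<lambda>t. z + w * of_real t) \<longlongrightarrow> z + w * of_real 0) (nhds (0::real))"
      by (intro tendsto_intros filterlim_ident)
    then have "eventually (\<lambda>t. z + w * of_real t \<in> S) (nhds (0::real))"
      using topological_tendstoD[of _ _ _ S] assms(2) that(2) by auto
    then show "eventually (\<lambda>t. u (z + w * of_real t) = v (z + w * of_real t)) (nhds (0::real))"
      by eventually_elim (use assms(3) in auto)
  qed
  show ?thesis
    using assms(1) d[where w=1] d[where w=\<i>] unfolding real_harmonic_on_def
    by (elim ex_forward conj_forward) auto
qed

lemma decomposes_as_imp_harmonic_on:
  assumes "decomposes_as f h g"
  shows "harmonic_on f \<D>"
proof -
  have f: "f z = h z + cnj (g z)" if "z \<in> \<D>" for z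
    using assms that by (auto simp: decomposes_as_def)
  have "(\<lambda>z. h z + g z) holomorphic_on \<D>" "(\<lambda>z. - \<i> * (h z - g z)) holomorphic_on \<D>"
    using assms unfolding decomposes_as_def by (auto intro!: holomorphic_intros)
  then have "real_harmonic_on (\<lambda>z. Re (h z + g z)) \<D>"
    and "real_harmonic_on (\<lambda>z. Re (- \<i> * (h z - g z))) \<D>"
    using real_harmonic_on_Re open_ball by blast+
  then show ?thesis
    unfolding harmonic_on_def using f
    by (intro conjI; elim real_harmonic_on_cong) auto
qed

end

theory Submission
  imports Defs
begin

text \<open>
The co-analytic part \<open>g\<close> vanishes, and the theorem then reduces to Friedman's theorem on univalent
analytic functions with integer coefficients.

For the first claim consider the dilatation \<open>\<omega> = g' / h'\<close>, which maps the disc into itself since \<open>f\<close>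
is sense-preserving. As \<open>h'\<close> has constant term 1, the lowest coefficient of \<open>\<omega>\<close> is a coefficient
\<open>(n + 1) * b (n + 1)\<close> of \<open>g'\<close>. If it is nonzero, its modulus is at least \<open>n + 1\<close>, which is more than
a map of the disc into itself allows (\<open>integer_coanalytic_part_vanishes\<close>).

So \<open>f = h\<close> is injective. Then \<open>q = z / h\<close> again has integer coefficients
\<open>1, c 1, c 2, ...\<close>, and \<open>1 / h = q / z\<close> is injective with a simple pole at 0. The area theorem
(\<open>area_theorem\<close>) gives \<open>(\<Sum>n\<ge>1. n * |c (n + 1)|^2) \<le> 1\<close>, and integers can satisfy this only if
\<open>q z = 1 + m * z + l * z^2\<close> with \<open>|l| \<le> 1\<close>. Since \<open>q\<close> is zero-free in the disc, this polynomial
is nonnegative at the end points 1 and -1 (\<open>zero_free_quadratic\<close>), which means \<open>|m| \<le> 1 + l\<close>. Nine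
pairs \<open>(m, l)\<close> remain, one for each function of the list (\<open>integer_univalent_functions\<close>).

The area theorem is usually proved by integrating along the boundary of the complement of the image,
which presupposes that a Jordan curve encloses a region of the expected area. Here only areas of
images of annuli \<open>\<rho> < |z| < r\<close> are compared. The area is bounded below through the change of variables
formula and Bessel's inequality on circles (\<open>area_of_annulus_image\<close>). It is bounded above by
enclosing the image in a disc, after a real-linear map that turns the nearly elliptic image of the
circle \<open>|z| = \<rho>\<close> into a nearly round one (\<open>area_inequality\<close>, \<open>nearly_circular_bound\<close>).\<close>

section \<open>Power series on the unit disc\<close>

definition disc_series :: "(nat \<Rightarrow> complex) \<Rightarrow> (complex \<Rightarrow> complex) \<Rightarrow> bool" where
  "disc_series c \<phi> \<longleftrightarrow> (\<forall>z\<in>\<D>. (\<lambda>n. c n * z ^ n) sums \<phi> z)"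

lemma disc_series_holomorphic:
  assumes "disc_series c \<phi>"
  shows "\<phi> holomorphic_on \<D>"
  using power_series_holomorphic[of 0 1 c \<phi>] assms by (auto simp: disc_series_def)

lemma disc_series_at_0:
  assumes "disc_series c \<phi>"
  shows "\<phi> 0 = c 0"
proof -
  have "(\<lambda>n. c n * 0 ^ n) sums \<phi> 0"
    using assms unfolding disc_series_def by (rule bspec) simp
  then show ?thesis
    by simp
qed

lemma holomorphic_disc_series:
  assumes "\<phi> holomorphic_on \<D>"
  shows "disc_series (\<lambda>n. (deriv ^^ n) \<phi> 0 / fact n) \<phi>"
  using holomorphic_power_series[OF assms] by (auto simp: disc_series_def)

lemma disc_series_diff:
  assumes "disc_series c \<phi>" "disc_series d \<psi>"
  shows "disc_series (\<lambda>n. c n - d n) (\<lambda>z. \<phi> z - \<psi> z)"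
  using assms by (auto simp: disc_series_def left_diff_distrib intro!: sums_diff)

lemma disc_series_cong:
  assumes "disc_series c \<phi>" "\<And>z. z \<in> \<D> \<Longrightarrow> \<phi> z = \<psi> z"
  shows "disc_series c \<psi>"
  using assms by (auto simp: disc_series_def)

lemma disc_series_unique:
  assumes "disc_series c \<phi>" "disc_series d \<phi>"
  shows "c = d"
proof (rule ccontr)
  assume "c \<noteq> d"
  define e where "e n = c n - d n" for n
  have e: "(\<lambda>n. e n * z ^ n) sums 0" if "z \<in> \<D>" for z
    using disc_series_diff[OF assms] that by (auto simp: disc_series_def e_def)
  obtain m where "e m \<noteq> 0"
    using \<open>c \<noteq> d\<close> by (auto simp: e_def)
  moreover have "e 0 = 0"
    using e[of 0] by simp
  ultimately have "m > 0"
    by (cases m) auto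
  have e': "\<And>z. cmod (z - 0) < 1 \<Longrightarrow> (\<lambda>n. e n * (z - 0) ^ n) sums 0"
    using e by simp
  show False
  proof (rule powser_0_nonzero[OF zero_less_one e' refl \<open>e m \<noteq> 0\<close> \<open>m > 0\<close>])
    fix s :: real assume "0 < s" "\<And>z::complex. z \<in> cball 0 s - {0} \<Longrightarrow> (0::complex) \<noteq> 0"
    from this(2)[of "of_real s"] this(1) show False
      by simp
  qed
qed

lemma disc_series_deriv:
  assumes "disc_series c \<phi>"
  shows "disc_series (\<lambda>n. of_nat (Suc n) * c (Suc n)) (deriv \<phi>)"
proof -
  have hol: "\<phi> holomorphic_on \<D>"
    using assms by (rule disc_series_holomorphic)
  have c: "c = (\<lambda>n. (deriv ^^ n) \<phi> 0 / fact n)"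
    using disc_series_unique[OF assms holomorphic_disc_series[OF hol]] .
  have "(\<lambda>n. of_nat (Suc n) * c (Suc n)) = (\<lambda>n. (deriv ^^ n) (deriv \<phi>) 0 / fact n)"
    by (rule ext) (simp add: c funpow_swap1 field_simps del: of_nat_Suc)
  then show ?thesis
    using holomorphic_disc_series[of "deriv \<phi>"] hol by (simp add: holomorphic_deriv)
qed

lemma disc_series_shift_up:
  assumes "disc_series c \<phi>"
  shows "disc_series (\<lambda>n. case n of 0 \<Rightarrow> 0 | Suc k \<Rightarrow> c k) (\<lambda>z. z * \<phi> z)"
  unfolding disc_series_def
proof
  fix z :: complex assume "z \<in> \<D>"
  then have "(\<lambda>n. z * (c n * z ^ n)) sums (z * \<phi> z)"
    using assms by (intro sums_mult) (auto simp: disc_series_def)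
  then have "(\<lambda>n. (case Suc n of 0 \<Rightarrow> 0 | Suc k \<Rightarrow> c k) * z ^ Suc n) sums (z * \<phi> z)"
    by (simp add: mult_ac)
  then show "(\<lambda>n. (case n of 0 \<Rightarrow> 0 | Suc k \<Rightarrow> c k) * z ^ n) sums (z * \<phi> z)"
    by (subst (asm) sums_Suc_iff) simp
qed

lemma disc_series_tail:
  assumes "disc_series c \<phi>"
  obtains \<psi> where "disc_series (\<lambda>n. c (Suc n)) \<psi>" "\<And>z. z \<in> \<D> \<Longrightarrow> \<phi> z = c 0 + z * \<psi> z"
proof
  define \<psi> where "\<psi> z = (\<Sum>n. c (Suc n) * z ^ n)" for z
  have sm: "summable (\<lambda>n. c n * z ^ n)" if "z \<in> \<D>" for z
    using assms that by (auto simp: disc_series_def sums_iff)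
  show "disc_series (\<lambda>n. c (Suc n)) \<psi>"
    using powser_split_head(3)[OF sm] by (auto simp: disc_series_def \<psi>_def intro: summable_sums)
  show "\<phi> z = c 0 + z * \<psi> z" if "z \<in> \<D>" for z
    using powser_split_head(1)[OF sm[OF that]] assms that
    by (auto simp: disc_series_def \<psi>_def sums_iff mult.commute)
qed

lemma disc_series_mult:
  assumes "disc_series c \<phi>" "disc_series d \<psi>"
  shows "disc_series (\<lambda>n. \<Sum>i\<le>n. c i * d (n - i)) (\<lambda>z. \<phi> z * \<psi> z)"
  unfolding disc_series_def
proof
  fix z :: complex assume z: "z \<in> \<D>"
  have abs: "summable (\<lambda>n. norm (e n * z ^ n))" if "disc_series e \<kappa>" for e \<kappa>
  proof (rule powser_insidea)
    define w :: complex where "w = of_real ((1 + norm z) / 2)"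
    have w: "norm w = (1 + norm z) / 2"
      unfolding w_def norm_of_real by simp
    show "norm z < norm w"
      using z w by simp
    show "summable (\<lambda>n. e n * w ^ n)"
      using that w z by (auto simp: disc_series_def sums_iff)
  qed
  have "(\<lambda>n. \<Sum>i\<le>n. (c i * z ^ i) * (d (n - i) * z ^ (n - i))) sums
        ((\<Sum>n. c n * z ^ n) * (\<Sum>n. d n * z ^ n))"
    using assms by (intro Cauchy_product_sums abs)
  moreover have "(\<Sum>i\<le>n. (c i * z ^ i) * (d (n - i) * z ^ (n - i))) =
                 (\<Sum>i\<le>n. c i * d (n - i)) * z ^ n" for n
    unfolding sum_distrib_right
  proof (rule sum.cong)
    fix i assume "i \<in> {..n}"
    then have "z ^ n = z ^ i * z ^ (n - i)"
      by (simp flip: power_add)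
    then show "c i * z ^ i * (d (n - i) * z ^ (n - i)) = c i * d (n - i) * z ^ n"
      by simp
  qed simp
  ultimately show "(\<lambda>n. (\<Sum>i\<le>n. c i * d (n - i)) * z ^ n) sums (\<phi> z * \<psi> z)"
    using assms z by (simp add: disc_series_def sums_iff)
qed

text \<open>The Cauchy product gives the coefficients of a quotient recursively, and the recursion only divides
by the leading coefficient \<open>c 0 = 1\<close> of the denominator.\<close>

lemma disc_series_quotient_Ints:
  assumes "disc_series c \<phi>" "disc_series d \<psi>" "disc_series e (\<lambda>z. \<psi> z * \<phi> z)"
    and "c 0 = 1" "\<And>n. c n \<in> \<int>" "\<And>n. e n \<in> \<int>"
  shows "d n \<in> \<int>"
proof (induction n rule: less_induct)
  case (less n)
  have "e n = (\<Sum>i\<le>n. d i * c (n - i))"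
    using disc_series_unique[OF assms(3) disc_series_mult[OF assms(2,1)]] by simp
  also have "\<dots> = (\<Sum>i<n. d i * c (n - i)) + d n"
    using assms(4) by (simp flip: lessThan_Suc_atMost)
  finally have "d n = e n - (\<Sum>i<n. d i * c (n - i))"
    by simp
  moreover have "(\<Sum>i<n. d i * c (n - i)) \<in> \<int>"
    using less assms(5) by (intro Ints_sum Ints_mult) auto
  ultimately show ?case
    using assms(6) by simp
qed

section \<open>Bessel's inequality on circles\<close>

lemma has_integral_circle_mean:
  fixes \<phi> :: "complex \<Rightarrow> complex"
  assumes "\<phi> holomorphic_on \<D>" "0 \<le> s" "s < 1"
  shows "((\<lambda>\<theta>. \<phi> (of_real s * cis \<theta>)) has_integral 2 * pi * \<phi> 0) {0..2*pi}"
proof (cases "s = 0")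
  case True
  then show ?thesis
    using has_integral_const_real[of "\<phi> 0" 0 "2*pi"] by (simp add: scaleR_conv_of_real)
next
  case False
  then have "s > 0" using assms by simp
  have hol: "\<phi> holomorphic_on cball 0 s"
    using assms by (auto elim: holomorphic_on_subset)
  have "((\<lambda>u. \<phi> u / (u - 0)) has_contour_integral 2 * of_real pi * \<i> * \<phi> 0) (circlepath 0 s)"
    using \<open>s > 0\<close> by (intro Cauchy_integral_circlepath_simple hol) auto
  then have "((\<lambda>\<theta>. \<phi> (of_real s * cis \<theta>) / (of_real s * cis \<theta>) * s * \<i> * cis \<theta>)
               has_integral 2 * pi * \<i> * \<phi> 0) {0..2*pi}"
    unfolding circlepath_def by (subst (asm) has_contour_integral_part_circlepath_iff) simp_all
  then have "((\<lambda>\<theta>. \<i> * \<phi> (of_real s * cis \<theta>)) has_integral \<i> * (2 * pi * \<phi> 0)) {0..2*pi}"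
    using \<open>s > 0\<close> by (simp add: field_simps)
  from has_integral_mult_right[OF this, of "-\<i>"] show ?thesis
    by (simp add: mult.assoc[symmetric])
qed

lemma integrable_circle:
  fixes \<phi> :: "complex \<Rightarrow> complex"
  assumes "\<phi> holomorphic_on \<D>" "0 \<le> s" "s < 1"
  shows "(\<lambda>\<theta>. (cmod (\<phi> (of_real s * cis \<theta>)))\<^sup>2) integrable_on {0..2*pi}"
proof (rule integrable_continuous_real)
  have "continuous_on {0..2*pi} (\<lambda>\<theta>. \<phi> (of_real s * cis \<theta>))"
    using assms
    by (intro continuous_on_compose2[OF holomorphic_on_imp_continuous_on[OF assms(1)]] continuous_intros)
       (auto simp: norm_mult)
  then show "continuous_on {0..2*pi} (\<lambda>\<theta>. (cmod (\<phi> (of_real s * cis \<theta>)))\<^sup>2)"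
    by (intro continuous_intros)
qed

text \<open>Writing \<open>\<phi> z = c 0 + z * \<psi> z\<close>, the two summands are orthogonal on every circle about 0, since
\<open>z * \<psi> z\<close> has mean value 0 there. Hence each step of the induction splits off one coefficient, and
no interchange of a series with an integral is needed.\<close>

lemma bessel_disc:
  assumes "disc_series c \<phi>" "0 \<le> s" "s < 1"
  shows "2 * pi * (\<Sum>n<N. (cmod (c n))\<^sup>2 * s ^ (2 * n))
           \<le> integral {0..2*pi} (\<lambda>\<theta>. (cmod (\<phi> (of_real s * cis \<theta>)))\<^sup>2)"
  using assms(1)
proof (induction N arbitrary: c \<phi>)
  case 0
  then show ?case
    using integrable_circle[OF disc_series_holomorphic[OF 0]] assms by (auto intro!: integral_nonneg)
next
  case (Suc N)
  obtain \<psi> where \<psi>: "disc_series (\<lambda>n. c (Suc n)) \<psi>" "\<And>z. z \<in> \<D> \<Longrightarrow> \<phi> z = c 0 + z * \<psi> z"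
    by (rule disc_series_tail[OF Suc.prems]) blast
  let ?u = "\<lambda>\<theta>. of_real s * cis \<theta>"
  have hol: "\<psi> holomorphic_on \<D>"
    using \<psi>(1) by (rule disc_series_holomorphic)
  have "(\<lambda>z. cnj (c 0) * (z * \<psi> z)) holomorphic_on \<D>"
    by (intro holomorphic_intros hol)
  then have "((\<lambda>\<theta>. cnj (c 0) * (?u \<theta> * \<psi> (?u \<theta>))) has_integral 0) {0..2*pi}"
    using has_integral_circle_mean[OF _ assms(2,3)] by fastforce
  from has_integral_linear[OF this bounded_linear_Re]
  have cross: "((\<lambda>\<theta>. Re (cnj (c 0) * (?u \<theta> * \<psi> (?u \<theta>)))) has_integral 0) {0..2*pi}"
    unfolding o_def zero_complex.sel .
  have const: "((\<lambda>\<theta>. (cmod (c 0))\<^sup>2) has_integral 2 * pi * (cmod (c 0))\<^sup>2) {0..2*pi}"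
    using has_integral_const_real[of "(cmod (c 0))\<^sup>2" 0 "2*pi"] by simp
  have tail: "((\<lambda>\<theta>. s\<^sup>2 * (cmod (\<psi> (?u \<theta>)))\<^sup>2) has_integral
                s\<^sup>2 * integral {0..2*pi} (\<lambda>\<theta>. (cmod (\<psi> (?u \<theta>)))\<^sup>2)) {0..2*pi}"
    by (intro has_integral_mult_right integrable_integral integrable_circle hol assms)
  have split: "(cmod (\<phi> (?u \<theta>)))\<^sup>2 = (cmod (c 0))\<^sup>2 + 2 * Re (cnj (c 0) * (?u \<theta> * \<psi> (?u \<theta>)))
                 + s\<^sup>2 * (cmod (\<psi> (?u \<theta>)))\<^sup>2" for \<theta>
  proof -
    have "?u \<theta> \<in> \<D>" using assms by (simp add: norm_mult)
    then have "\<phi> (?u \<theta>) = c 0 + ?u \<theta> * \<psi> (?u \<theta>)" by (rule \<psi>(2))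
    moreover have "(cmod (x + y))\<^sup>2 = (cmod x)\<^sup>2 + 2 * Re (cnj x * y) + (cmod y)\<^sup>2" for x y
      by (simp only: cmod_power2) (simp add: power2_eq_square algebra_simps)
    moreover have "(cmod (?u \<theta> * \<psi> (?u \<theta>)))\<^sup>2 = s\<^sup>2 * (cmod (\<psi> (?u \<theta>)))\<^sup>2"
      by (simp add: norm_mult power_mult_distrib)
    ultimately show ?thesis by metis
  qed
  have "((\<lambda>\<theta>. (cmod (\<phi> (?u \<theta>)))\<^sup>2) has_integral 2 * pi * (cmod (c 0))\<^sup>2 + 2 * 0
          + s\<^sup>2 * integral {0..2*pi} (\<lambda>\<theta>. (cmod (\<psi> (?u \<theta>)))\<^sup>2)) {0..2*pi}"
    unfolding split by (intro has_integral_add has_integral_mult_right const cross tail)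
  then have "integral {0..2*pi} (\<lambda>\<theta>. (cmod (\<phi> (?u \<theta>)))\<^sup>2) =
      2 * pi * (cmod (c 0))\<^sup>2 + s\<^sup>2 * integral {0..2*pi} (\<lambda>\<theta>. (cmod (\<psi> (?u \<theta>)))\<^sup>2)"
    by (simp add: integral_unique)
  moreover have "s\<^sup>2 * (2 * pi * (\<Sum>n<N. (cmod (c (Suc n)))\<^sup>2 * s ^ (2 * n)))
      \<le> s\<^sup>2 * integral {0..2*pi} (\<lambda>\<theta>. (cmod (\<psi> (?u \<theta>)))\<^sup>2)"
    by (intro mult_left_mono Suc.IH[OF \<psi>(1)]) simp
  moreover have "2 * pi * (\<Sum>n<Suc N. (cmod (c n))\<^sup>2 * s ^ (2 * n)) =
      2 * pi * (cmod (c 0))\<^sup>2 + s\<^sup>2 * (2 * pi * (\<Sum>n<N. (cmod (c (Suc n)))\<^sup>2 * s ^ (2 * n)))"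
    by (simp add: sum.lessThan_Suc_shift sum_distrib_left power_add algebra_simps power2_eq_square del: sum.lessThan_Suc)
  ultimately show ?case
    by linarith
qed

section \<open>The area of a planar image\<close>

text \<open>The change of variables formula lives on \<open>real^2\<close>; these two mutually inverse isometries transport
it to the complex plane.\<close>

definition vec_of :: "complex \<Rightarrow> real^2" where
  "vec_of z = vector [Re z, Im z]"

definition cplx_of :: "real^2 \<Rightarrow> complex" where
  "cplx_of x = Complex (x $ 1) (x $ 2)"

lemma vec_of_nth [simp]: "vec_of z $ 1 = Re z" "vec_of z $ 2 = Im z"
  by (simp_all add: vec_of_def)

lemma cplx_of_sel [simp]: "Re (cplx_of x) = x $ 1" "Im (cplx_of x) = x $ 2"
  by (simp_all add: cplx_of_def)

lemma vec_of_cplx_of [simp]: "vec_of (cplx_of x) = x"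
  by (simp add: vec_eq_iff forall_2)

lemma cplx_of_vec_of [simp]: "cplx_of (vec_of z) = z"
  by (simp add: complex_eq_iff)

lemma norm_vec_of [simp]: "norm (vec_of z) = cmod z"
  by (simp add: norm_vec_def L2_set_def UNIV_2 cmod_def)

lemma bounded_linear_vec_of: "bounded_linear vec_of"
proof
  show "vec_of (x + y) = vec_of x + vec_of y" for x y
    by (simp add: vec_eq_iff forall_2)
  show "vec_of (r *\<^sub>R x) = r *\<^sub>R vec_of x" for r x
    by (simp add: vec_eq_iff forall_2)
  show "\<exists>K. \<forall>x. norm (vec_of x) \<le> norm x * K"
    by (intro exI[of _ 1]) simp
qed

lemma norm_cplx_of [simp]: "cmod (cplx_of x) = norm x"
  using norm_vec_of[of "cplx_of x"] by simp

lemma bounded_linear_cplx_of: "bounded_linear cplx_of"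
proof
  show "cplx_of (x + y) = cplx_of x + cplx_of y" for x y
    by (simp add: complex_eq_iff)
  show "cplx_of (r *\<^sub>R x) = r *\<^sub>R cplx_of x" for r x
    by (simp add: complex_eq_iff)
  show "\<exists>K. \<forall>x. norm (cplx_of x) \<le> norm x * K"
    by (intro exI[of _ 1]) simp
qed

lemma mem_box_cplx_of:
  "x \<in> box (vec_of a) (vec_of b) \<longleftrightarrow> cplx_of x \<in> box a b"
  "x \<in> cbox (vec_of a) (vec_of b) \<longleftrightarrow> cplx_of x \<in> cbox a b"
  by (auto simp: mem_box_cart forall_2 in_box_complex_iff in_cbox_complex_iff)

lemma integral_cbox_vec_of:
  fixes f :: "complex \<Rightarrow> real"
  assumes "continuous_on (cbox a b) f"
  shows "integral (cbox (vec_of a) (vec_of b)) (\<lambda>x. f (cplx_of x)) =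
         integral {Re a..Re b} (\<lambda>x. integral {Im a..Im b} (\<lambda>y. f (Complex x y)))"
proof -
  define F where "F = (\<lambda>p. f (Complex (fst p) (snd p)))"
  define u :: "real^2 \<Rightarrow> real \<times> real" where "u x = (x $ 1, x $ 2)" for x
  define v :: "real \<times> real \<Rightarrow> real^2" where "v p = vector [fst p, snd p]" for p
  have vn: "v p $ 1 = fst p" "v p $ 2 = snd p" for p
    by (simp_all add: v_def)
  have uv: "u (v p) = p" "v (u x) = x" for p x
    by (simp_all add: u_def vn vec_eq_iff forall_2)
  have uc: "u ` cbox p q = cbox (u p) (u q)" for p q
  proof (intro equalityI subsetI)
    fix w assume "w \<in> cbox (u p) (u q)"
    then have "v w \<in> cbox p q"
      by (cases w) (auto simp: mem_box_cart forall_2 vn u_def cbox_Pair_eq)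
    then show "w \<in> u ` cbox p q"
      using uv(1) by (metis imageI)
  qed (auto simp: mem_box_cart forall_2 u_def cbox_Pair_eq)
  have vc: "v ` cbox p q = cbox (v p) (v q)" for p q
  proof -
    have "cbox (v p) (v q) = v ` u ` cbox (v p) (v q)"
      by (simp add: image_image uv)
    then show ?thesis
      by (simp add: uc uv)
  qed
  have cont: "measure lborel (u ` cbox p q) = measure lborel (cbox p q)" for p q
  proof -
    have "(\<exists>i::2. Q i) \<longleftrightarrow> Q 1 \<or> Q 2" for Q
      by (metis exhaust_2)
    then show ?thesis
      unfolding uc
      by (auto simp: u_def content_Pair content_cbox_if_cart UNIV_2 interval_eq_empty_cart)
  qed
  have F: "continuous_on (cbox (Re a, Im a) (Re b, Im b)) F"
    unfolding F_def
    by (intro continuous_on_compose2[OF assms] continuous_intros)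
       (auto simp: in_cbox_complex_iff cbox_Pair_eq Complex_eq)
  have "(F has_integral integral (cbox (Re a, Im a) (Re b, Im b)) F) (cbox (Re a, Im a) (Re b, Im b))"
    by (intro integrable_integral integrable_continuous F)
  then have "((\<lambda>x. F (u x)) has_integral (1 / 1) *\<^sub>R integral (cbox (Re a, Im a) (Re b, Im b)) F)
          (v ` cbox (Re a, Im a) (Re b, Im b))"
  proof (rule has_integral_twiddle[OF zero_less_one uv(2) uv(1), rotated -1])
    show "continuous (at x) u" for x
      unfolding u_def by (intro continuous_intros)
    show "\<exists>w z. u ` cbox p q = cbox w z" for p q
      using uc by blast
    show "\<exists>w z. v ` cbox p q = cbox w z" for p q
      using vc by blast
    show "measure lborel (u ` cbox p q) = 1 * measure lborel (cbox p q)" for p q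
      by (simp add: cont)
  qed
  moreover have "v ` cbox (Re a, Im a) (Re b, Im b) = cbox (vec_of a) (vec_of b)"
    unfolding vc by (simp add: v_def vec_of_def)
  moreover have "F (u x) = f (cplx_of x)" for x
    by (simp add: F_def u_def cplx_of_def)
  ultimately have "integral (cbox (vec_of a) (vec_of b)) (\<lambda>x. f (cplx_of x)) =
      integral (cbox (Re a, Im a) (Re b, Im b)) F"
    by (simp add: integral_unique)
  also have "\<dots> = integral {Re a..Re b} (\<lambda>x. integral {Im a..Im b} (\<lambda>y. f (Complex x y)))"
    using integral_prod_continuous[OF F] by (simp add: F_def)
  finally show ?thesis .
qed

text \<open>The real-linear map \<open>w \<mapsto> w - c * cnj w\<close> has determinant \<open>1 - |c|^2\<close>, and multiplication by \<open>p\<close> has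
determinant \<open>|p|^2\<close>.\<close>

lemma det_real_linear:
  "det (matrix (\<lambda>x. vec_of (p * cplx_of x - c * cnj (p * cplx_of x)))) =
     (cmod p)\<^sup>2 * (1 - (cmod c)\<^sup>2)"
proof -
  have "cplx_of (axis 1 1) = 1" "cplx_of (axis 2 1) = \<i>"
    by (simp_all add: complex_eq_iff axis_def)
  then have "det (matrix (\<lambda>x. vec_of (p * cplx_of x - c * cnj (p * cplx_of x)))) =
      Re (p - c * cnj p) * Im (p * \<i> - c * cnj (p * \<i>)) - Re (p * \<i> - c * cnj (p * \<i>)) * Im (p - c * cnj p)"
    by (simp only: det_2 matrix_def vec_lambda_beta vec_of_nth mult_1_right)
  also have "\<dots> = ((Re p)\<^sup>2 + (Im p)\<^sup>2) * (1 - ((Re c)\<^sup>2 + (Im c)\<^sup>2))"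
    by (simp add: algebra_simps power2_eq_square)
  finally show ?thesis
    by (simp only: cmod_power2)
qed

text \<open>The left-hand side is the area of the image of the rectangle under \<open>P - c * cnj P\<close>, which inherits
injectivity from \<open>P\<close> because \<open>w \<mapsto> w - c * cnj w\<close> is invertible for \<open>|c| < 1\<close>. The freedom to choose
\<open>c\<close> serves to make the image nearly round, so that a surrounding disc estimates its area sharply.\<close>

lemma area_inequality:
  fixes P :: "complex \<Rightarrow> complex"
  assumes hol: "P holomorphic_on U" "open U" "cbox a b \<subseteq> U"
    and inj: "inj_on P (box a b)"
    and c: "cmod c < 1"
    and le: "\<And>\<zeta>. \<zeta> \<in> box a b \<Longrightarrow> cmod (P \<zeta> - c * cnj (P \<zeta>)) \<le> R"
    and "R \<ge> 0"
  shows "(1 - (cmod c)\<^sup>2) *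
           integral {Re a..Re b} (\<lambda>x. integral {Im a..Im b} (\<lambda>y. (cmod (deriv P (Complex x y)))\<^sup>2))
         \<le> pi * R\<^sup>2"
proof -
  let ?S = "box (vec_of a) (vec_of b)"
  define f where "f x = vec_of (P (cplx_of x) - c * cnj (P (cplx_of x)))" for x
  define f' where "f' x = (\<lambda>u. vec_of (deriv P (cplx_of x) * cplx_of u
       - c * cnj (deriv P (cplx_of x) * cplx_of u)))" for x
  define J where "J \<zeta> = (cmod (deriv P \<zeta>))\<^sup>2 * (1 - (cmod c)\<^sup>2)" for \<zeta>
  have c1: "1 - (cmod c)\<^sup>2 > 0"
    using c by (simp add: power_less_one_iff abs_square_less_1)
  have der: "(f has_derivative f' x) (at x within ?S)" if "x \<in> ?S" for x
  proof -
    have x: "cplx_of x \<in> U"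
      using that hol(3) box_subset_cbox by (auto simp: mem_box_cplx_of)
    have "(P has_derivative (*) (deriv P (cplx_of x))) (at (cplx_of x))"
      using holomorphic_derivI[OF hol(1,2) x] by (simp add: has_field_derivative_def)
    then have "((\<lambda>x. P (cplx_of x)) has_derivative (\<lambda>u. deriv P (cplx_of x) * cplx_of u)) (at x within ?S)"
      by (rule has_derivative_compose[OF bounded_linear_imp_has_derivative[OF bounded_linear_cplx_of]])
    then show ?thesis
      unfolding f_def f'_def
      by (intro bounded_linear.has_derivative[OF bounded_linear_vec_of] has_derivative_diff
          has_derivative_mult_right has_derivative_cnj)
  qed
  have injf: "inj_on f ?S"
  proof (rule inj_onI)
    fix x y assume xy: "x \<in> ?S" "y \<in> ?S" "f x = f y"
    define d where "d = P (cplx_of x) - P (cplx_of y)"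
    have "P (cplx_of x) - c * cnj (P (cplx_of x)) = P (cplx_of y) - c * cnj (P (cplx_of y))"
      using arg_cong[OF xy(3), of cplx_of] by (simp add: f_def)
    then have "d = c * cnj d"
      by (simp add: d_def algebra_simps)
    then have "cmod d = cmod c * cmod d"
      by (metis complex_mod_cnj norm_mult)
    then have "d = 0"
      using c by auto
    then have "cplx_of x = cplx_of y"
      using inj xy(1,2) by (auto simp: d_def mem_box_cplx_of dest: inj_onD)
    then show "x = y"
      by (metis vec_of_cplx_of)
  qed
  have det: "\<bar>det (matrix (f' x))\<bar> = J (cplx_of x)" for x
    unfolding f'_def det_real_linear J_def using c1 by (simp add: abs_mult)
  have contJ: "continuous_on (cbox a b) J"
    unfolding J_def
    by (intro continuous_intros continuous_on_subset[OF _ hol(3)] holomorphic_on_imp_continuous_on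
        holomorphic_deriv hol)
  have "continuous_on (cbox (vec_of a) (vec_of b)) (\<lambda>x. J (cplx_of x))"
    by (intro continuous_on_compose2[OF contJ] linear_continuous_on bounded_linear_cplx_of)
       (auto simp: mem_box_cplx_of)
  then have int: "(\<lambda>x. J (cplx_of x)) integrable_on ?S"
    using integrable_continuous integrable_on_open_interval by blast
  have meas: "measure lebesgue (f ` ?S) = integral ?S (\<lambda>x. J (cplx_of x))"
    using measure_differentiable_image_eq[of ?S f f'] der injf int by (simp add: det)
  have "f ` ?S \<in> lmeasurable"
    using measurable_differentiable_image_eq[of ?S f f'] der injf int by (simp add: det)
  moreover have "f ` ?S \<subseteq> cball 0 R"
    using le by (auto simp: f_def mem_box_cplx_of)
  ultimately have "measure lebesgue (f ` ?S) \<le> measure lebesgue (cball (0 :: real^2) R)"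
    by (intro measure_mono_fmeasurable lmeasurable_cball) (auto simp: fmeasurable_def)
  also have "\<dots> = pi * R\<^sup>2"
    using content_cball[of R "0 :: real^2"] \<open>R \<ge> 0\<close> by (simp add: unit_ball_vol_2)
  finally have "integral (cbox (vec_of a) (vec_of b)) (\<lambda>x. J (cplx_of x)) \<le> pi * R\<^sup>2"
    by (simp add: meas integral_open_interval)
  then show ?thesis
    unfolding integral_cbox_vec_of[OF contJ] by (simp add: J_def mult.commute)
qed

section \<open>The area theorem\<close>

text \<open>On the circle of radius \<open>\<rho>\<close> one has \<open>1 / cnj z = z / \<rho>^2\<close>, so that \<open>1 / z + b * z\<close> traces the ellipse
which is the image of a circle under \<open>w \<mapsto> w + b * \<rho>^2 * cnj w\<close>. Subtracting
\<open>b * \<rho>^2 * cnj F\<close> undoes this distortion up to an error of order \<open>\<rho>^2\<close>. Points with \<open>|z| > \<rho>\<close> only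
map further inside, because there \<open>1 / |z|\<close> decreases faster than the other terms grow; this is where
the smallness of \<open>\<rho>\<close> enters.\<close>

lemma nearly_circular_bound:
  fixes z b w :: complex
  assumes "0 < \<rho>" "\<rho> \<le> cmod z" "cmod z \<le> 1"
    and w: "cmod w \<le> C * (cmod z)\<^sup>2"
    and small: "2 * \<rho> * (cmod b + C) \<le> 1"
  defines "F \<equiv> 1 / z + b * z + w"
  shows "cmod (F - of_real (\<rho>\<^sup>2) * b * cnj F) \<le> 1 / \<rho> + (C + cmod b * (cmod b + C)) * \<rho>\<^sup>2"
proof -
  define s B where "s = cmod z" and "B = cmod b"
  have s: "0 < s" "\<rho> \<le> s" "s \<le> 1" "B \<ge> 0"
    using assms by (auto simp: s_def B_def)
  have "0 \<le> C * s\<^sup>2"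
    using w order_trans[OF norm_ge_zero] unfolding s_def by blast
  then have C: "C \<ge> 0"
    using s by (simp add: zero_le_mult_iff)
  have "z \<noteq> 0" using s by (auto simp: s_def)
  \<comment> \<open>reflection in the circle of radius \<open>s\<close>\<close>
  have inv: "1 / cnj z = z / of_real (s\<^sup>2)"
    using \<open>z \<noteq> 0\<close> complex_norm_square[of z] by (simp add: s_def field_simps)
  have "F - of_real (\<rho>\<^sup>2) * b * cnj F =
      1 / z + of_real (1 - \<rho>\<^sup>2 / s\<^sup>2) * (b * z) + w - of_real (\<rho>\<^sup>2) * (b * cnj (b * z + w))"
    using inv by (simp add: F_def algebra_simps)
  also have "cmod \<dots> \<le> cmod (1 / z) + cmod (of_real (1 - \<rho>\<^sup>2 / s\<^sup>2) * (b * z)) + cmod w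
      + cmod (of_real (\<rho>\<^sup>2) * (b * cnj (b * z + w)))"
    by (intro order_trans[OF norm_triangle_ineq4] add_mono order_trans[OF norm_triangle_ineq] order_refl)
  also have "cmod (1 / z) = 1 / s"
    by (simp add: s_def norm_divide)
  also have "cmod (of_real (1 - \<rho>\<^sup>2 / s\<^sup>2) * (b * z)) = (1 - \<rho>\<^sup>2 / s\<^sup>2) * (B * s)"
  proof -
    have "\<rho>\<^sup>2 / s\<^sup>2 \<le> 1"
      using s assms(1) by (simp add: power_mono)
    then show ?thesis
      by (simp only: norm_mult norm_of_real s_def B_def)
  qed
  also have "cmod w \<le> C * s\<^sup>2"
    using w by (simp add: s_def)
  also have "cmod (of_real (\<rho>\<^sup>2) * (b * cnj (b * z + w))) \<le> \<rho>\<^sup>2 * (B * (B + C))"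
  proof -
    have "s\<^sup>2 \<le> 1" using s by (simp add: power_le_one)
    then have "cmod w \<le> C"
      using w C mult_left_mono[of "s\<^sup>2" 1 C] by (simp add: s_def)
    moreover have "cmod (b * z) \<le> B"
      using s mult_left_mono[of s 1 B] by (simp add: norm_mult s_def B_def)
    ultimately have "cmod (b * z + w) \<le> B + C"
      using norm_triangle_ineq[of "b * z" w] by linarith
    moreover have "cmod (of_real (\<rho>\<^sup>2) * (b * cnj (b * z + w))) = \<rho>\<^sup>2 * (B * cmod (b * z + w))"
      by (simp only: norm_mult norm_of_real complex_mod_cnj B_def) simp
    ultimately show ?thesis
      using s by (simp add: mult_left_mono)
  qed
  also have "1 / s + (1 - \<rho>\<^sup>2 / s\<^sup>2) * (B * s) + C * s\<^sup>2 + \<rho>\<^sup>2 * (B * (B + C))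
      \<le> 1 / \<rho> + (C + B * (B + C)) * \<rho>\<^sup>2"
  proof -
    \<comment> \<open>the difference of the two sides has the factor \<open>s - \<rho>\<close>; its cofactor is nonnegative for small \<open>\<rho>\<close>\<close>
    have "\<rho> * (s + \<rho>) * (B + C * s) \<le> \<rho> * 2 * (B + C)"
      using s assms(1) C mult_left_mono[of s 1 C] by (intro mult_mono) auto
    then have "0 \<le> (s - \<rho>) * (1 - \<rho> * (s + \<rho>) * (B + C * s))"
      using s small by (simp add: B_def mult_ac)
    then have "0 \<le> (s - \<rho>) * (1 - \<rho> * (s + \<rho>) * (B + C * s)) / (\<rho> * s)"
      using s assms(1) by simp
    also have "\<dots> = 1 / \<rho> - 1 / s - (1 - \<rho>\<^sup>2 / s\<^sup>2) * (B * s) - C * (s\<^sup>2 - \<rho>\<^sup>2)"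
      using s assms(1) by (simp add: field_simps power2_eq_square)
    finally show ?thesis
      by (simp add: algebra_simps)
  qed
  finally show ?thesis
    by (simp add: B_def)
qed

text \<open>In the logarithmic coordinate \<open>\<zeta> = ln z\<close> an annulus is a rectangle, and there
\<open>P' = (z * q' - q) / z\<close> with \<open>z = exp \<zeta>\<close>. Bessel's inequality on each vertical side, integrated over
\<open>Re \<zeta>\<close>, bounds the area of the image, counted with multiplicity, from below; the terms
\<open>exp (- 2 * t) - exp (- 2 * T)\<close> stem from the pole \<open>1 / z\<close>. The translation by \<open>k\<close> permits centring
the image.\<close>

lemma area_of_annulus_image:
  fixes q :: "complex \<Rightarrow> complex" and k :: complex
  assumes q: "disc_series c q" and "c 0 = 1" and t: "t \<le> T" "T < 0"
  defines "P \<equiv> \<lambda>\<zeta>. q (exp \<zeta>) / exp \<zeta> - k"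
  shows "pi * (exp (- 2 * t) - exp (- 2 * T) +
             (\<Sum>n<N. (real n + 1) * (cmod (c (n + 2)))\<^sup>2 * (exp T ^ (2 * n + 2) - exp t ^ (2 * n + 2))))
         \<le> integral {t..T} (\<lambda>x. integral {0..2*pi} (\<lambda>y. (cmod (deriv P (Complex x y)))\<^sup>2))"
    and "P holomorphic_on {\<zeta>. Re \<zeta> < 0}"
proof -
  define H where "H = {\<zeta>. Re \<zeta> < 0}"
  have "open H"
    unfolding H_def by (rule open_halfspace_Re_lt)
  have expD: "exp \<zeta> \<in> \<D>" if "\<zeta> \<in> H" for \<zeta> :: complex
    using that by (simp add: H_def)
  have qh: "q holomorphic_on \<D>"
    using q by (rule disc_series_holomorphic)
  have qe: "(\<lambda>\<zeta>. q (exp \<zeta>)) holomorphic_on H"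
    using holomorphic_on_compose_gen[OF holomorphic_on_exp qh, of H] expD
    by (simp add: o_def image_subset_iff)
  have Ph: "P holomorphic_on H"
    unfolding P_def by (intro holomorphic_intros qe) auto
  then show "P holomorphic_on {\<zeta>. Re \<zeta> < 0}"
    by (simp add: H_def)
  define \<phi> where "\<phi> z = z * deriv q z - q z" for z
  \<comment> \<open>the coefficients of \<open>z * q' - q\<close>; the factor vanishes at \<open>n = 1\<close> and is -1 at \<open>n = 0\<close>, where the pole sits\<close>
  define d where "d n = (of_nat n - 1) * c n" for n
  have d: "disc_series d \<phi>"
  proof -
    have "(\<lambda>n. (case n of 0 \<Rightarrow> 0 | Suc k \<Rightarrow> of_nat (Suc k) * c (Suc k)) - c n) = d"
      by (rule ext) (auto simp: d_def algebra_simps split: nat.splits)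
    then show ?thesis
      using disc_series_diff[OF disc_series_shift_up[OF disc_series_deriv[OF q]] q]
      by (simp add: \<phi>_def[abs_def])
  qed
  have dP: "deriv P \<zeta> = \<phi> (exp \<zeta>) / exp \<zeta>" if "\<zeta> \<in> H" for \<zeta>
  proof -
    have "(q has_field_derivative deriv q (exp \<zeta>)) (at (exp \<zeta>))"
      using holomorphic_derivI[OF qh open_ball expD[OF that]] .
    then have "((\<lambda>\<zeta>. q (exp \<zeta>)) has_field_derivative deriv q (exp \<zeta>) * exp \<zeta>) (at \<zeta>)"
      by (rule DERIV_chain2) (auto intro: derivative_eq_intros)
    then have "(P has_field_derivative
        (deriv q (exp \<zeta>) * exp \<zeta> * exp \<zeta> - q (exp \<zeta>) * exp \<zeta>) / (exp \<zeta> * exp \<zeta>)) (at \<zeta>)"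
      unfolding P_def by (auto intro!: derivative_eq_intros)
    then show ?thesis
      by (simp add: DERIV_imp_deriv \<phi>_def field_simps)
  qed
  define G where "G x = integral {0..2*pi} (\<lambda>y. (cmod (deriv P (Complex x y)))\<^sup>2)" for x
  define g where "g x = 2 * pi * (\<Sum>n<N+2. (real n - 1)\<^sup>2 * (cmod (c n))\<^sup>2 * exp (2 * (real n - 1) * x))" for x
  \<comment> \<open>an antiderivative of \<open>g\<close>, the lower bound for the inner integral \<open>G\<close>\<close>
  define A where "A x = pi * (\<Sum>n<N+2. (real n - 1) * (cmod (c n))\<^sup>2 * exp (2 * (real n - 1) * x))" for x
  have gG: "g x \<le> G x" if "x \<in> {t..T}" for x
  proof -
    have x: "x < 0" using that t by simp
    have cx: "exp (Complex x y) = of_real (exp x) * cis y" for y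
      by (simp add: exp_eq_polar)
    have "(cmod (deriv P (Complex x y)))\<^sup>2 = (cmod (\<phi> (of_real (exp x) * cis y)))\<^sup>2 * exp (- 2 * x)" for y
    proof -
      have "cmod (deriv P (Complex x y)) = cmod (\<phi> (of_real (exp x) * cis y)) / exp x"
        using dP[of "Complex x y"] x cx[of y] by (simp add: H_def norm_divide norm_mult)
      moreover have "exp (- 2 * x) = 1 / (exp x)\<^sup>2"
        by (simp add: exp_minus exp_double divide_inverse)
      ultimately show ?thesis
        by (simp add: power_divide)
    qed
    then have Gx: "G x = integral {0..2*pi} (\<lambda>y. (cmod (\<phi> (of_real (exp x) * cis y)))\<^sup>2) * exp (- 2 * x)"
      by (simp add: G_def)
    have bessel: "2 * pi * (\<Sum>n<N+2. (cmod (d n))\<^sup>2 * exp x ^ (2 * n)) \<le>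
        integral {0..2*pi} (\<lambda>y. (cmod (\<phi> (of_real (exp x) * cis y)))\<^sup>2)"
      using x by (intro bessel_disc d) auto
    have gx: "2 * pi * (\<Sum>n<N+2. (cmod (d n))\<^sup>2 * exp x ^ (2 * n)) * exp (- 2 * x) = g x"
    proof -
      have "(cmod (d n))\<^sup>2 * exp x ^ (2 * n) * exp (- 2 * x) =
          (real n - 1)\<^sup>2 * (cmod (c n))\<^sup>2 * exp (2 * (real n - 1) * x)" for n
      proof -
        have "cmod (of_nat n - 1) = \<bar>real n - 1\<bar>"
          by (metis norm_of_real of_real_1 of_real_diff of_real_of_nat_eq)
        moreover have "exp x ^ (2 * n) * exp (- 2 * x) = exp (2 * (real n - 1) * x)"
          by (simp add: exp_of_nat_mult[symmetric] exp_add[symmetric] algebra_simps)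
        ultimately show ?thesis
          by (simp add: d_def norm_mult power_mult_distrib mult.assoc)
      qed
      then show ?thesis
        by (simp only: g_def sum_distrib_right mult.assoc)
    qed
    show ?thesis
      unfolding Gx gx[symmetric] by (intro mult_right_mono bessel) simp
  qed
  have "(A has_vector_derivative g x) (at x within {t..T})" for x
    unfolding A_def g_def has_real_derivative_iff_has_vector_derivative[symmetric]
    by (auto intro!: derivative_eq_intros sum.cong simp: sum_distrib_left power2_eq_square algebra_simps)
  then have gi: "(g has_integral A T - A t) {t..T}"
    using t by (intro fundamental_theorem_of_calculus) auto
  have "continuous_on {t..T} G"
  proof -
    have "continuous_on H (deriv P)"
      using Ph \<open>open H\<close> by (intro holomorphic_on_imp_continuous_on holomorphic_deriv)
    moreover have "continuous_on ({t..T} \<times> cbox 0 (2*pi)) (\<lambda>p. Complex (fst p) (snd p))"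
      unfolding Complex_eq by (intro continuous_intros)
    ultimately have "continuous_on ({t..T} \<times> cbox 0 (2*pi)) (\<lambda>p. deriv P (Complex (fst p) (snd p)))"
      by (rule continuous_on_compose2) (use t in \<open>auto simp: H_def\<close>)
    then have "continuous_on ({t..T} \<times> cbox 0 (2*pi)) (\<lambda>p. (cmod (deriv P (Complex (fst p) (snd p))))\<^sup>2)"
      by (intro continuous_on_power continuous_on_norm)
    then show ?thesis
      using integral_continuous_on_param[of "{t..T}" 0 "2*pi" "\<lambda>x y. (cmod (deriv P (Complex x y)))\<^sup>2"]
      by (simp add: G_def[abs_def] case_prod_unfold)
  qed
  then have "(G has_integral integral {t..T} G) {t..T}"
    by (intro integrable_integral integrable_continuous_real)
  with gi have "A T - A t \<le> integral {t..T} G"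
    using gG by (rule has_integral_le)
  moreover have "A T - A t = pi * (exp (- 2 * t) - exp (- 2 * T) +
      (\<Sum>n<N. (real n + 1) * (cmod (c (n + 2)))\<^sup>2 * (exp T ^ (2 * n + 2) - exp t ^ (2 * n + 2))))"
  proof -
    have e: "exp (2 * (real (Suc (Suc n)) - 1) * x) = exp x ^ (2 * n + 2)" for n x
      by (simp add: exp_of_nat_mult[symmetric] exp_add[symmetric] algebra_simps flip: power_Suc)
    have s: "A x = pi * ((\<Sum>n<N. (real n + 1) * (cmod (c (n + 2)))\<^sup>2 * exp x ^ (2 * n + 2)) - exp (- 2 * x))" for x
      unfolding A_def using \<open>c 0 = 1\<close>
      by (simp only: add_2_eq_Suc' sum.lessThan_Suc_shift e) (simp add: add.commute)
    show ?thesis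
      unfolding s by (simp add: algebra_simps sum_subtractf)
  qed
  ultimately show "pi * (exp (- 2 * t) - exp (- 2 * T) +
             (\<Sum>n<N. (real n + 1) * (cmod (c (n + 2)))\<^sup>2 * (exp T ^ (2 * n + 2) - exp t ^ (2 * n + 2))))
         \<le> integral {t..T} (\<lambda>x. integral {0..2*pi} (\<lambda>y. (cmod (deriv P (Complex x y)))\<^sup>2))"
    by (simp add: G_def[abs_def])
qed

text \<open>Gronwall's area theorem for \<open>q z / z = 1 / z + c 1 + c 2 * z + ...\<close>. The area of the image of an
annulus \<open>\<rho> < |z| < r\<close> is at least \<open>\<pi>\<close> times the partial sums of
\<open>1 / \<rho>^2 - 1 / r^2 + (\<Sum>n. (n + 1) * |c (n + 2)|^2 * (r ^ (2 * n + 2) - \<rho> ^ (2 * n + 2)))\<close>. By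
injectivity it is also at most about \<open>\<pi> / \<rho>^2\<close>, with an error that vanishes as \<open>\<rho> \<rightarrow> 0\<close>: after
the linear change \<open>w \<mapsto> w - \<gamma> * cnj w\<close> with \<open>\<gamma> = c 2 * \<rho>^2\<close> the image lies in a disc of radius
\<open>1 / \<rho> + O(\<rho>^2)\<close>. The terms \<open>1 / \<rho>^2\<close> cancel; then \<open>\<rho> \<rightarrow> 0\<close> and \<open>r \<rightarrow> 1\<close>. A disc
around the untransformed image would be too large by about \<open>2 * \<pi> * |c 2|\<close>, which does not vanish.\<close>

lemma area_theorem:
  fixes q :: "complex \<Rightarrow> complex"
  assumes q: "disc_series c q" and c0: "c 0 = 1"
    and inj: "inj_on (\<lambda>z. q z / z) (\<D> - {0})"
  shows "(\<Sum>n<N. (real n + 1) * (cmod (c (n + 2)))\<^sup>2) \<le> 1"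
proof -
  define S where "S x = (\<Sum>n<N. (real n + 1) * (cmod (c (n + 2)))\<^sup>2 * x ^ (2 * n + 2))" for x :: real
  have S0: "S 0 = 0"
    by (simp add: S_def)
  have contS: "(S \<longlongrightarrow> S x) (at x within X)" for x X
    unfolding S_def by (intro tendsto_intros)
  obtain q1 where q1: "disc_series (\<lambda>n. c (Suc n)) q1" "\<And>z. z \<in> \<D> \<Longrightarrow> q z = c 0 + z * q1 z"
    by (rule disc_series_tail[OF q]) blast
  obtain q2 where q2: "disc_series (\<lambda>n. c (Suc (Suc n))) q2" "\<And>z. z \<in> \<D> \<Longrightarrow> q1 z = c (Suc 0) + z * q2 z"
    by (rule disc_series_tail[OF q1(1)]) blast
  obtain q3 where q3: "disc_series (\<lambda>n. c (Suc (Suc (Suc n)))) q3" "\<And>z. z \<in> \<D> \<Longrightarrow> q2 z = c (Suc (Suc 0)) + z * q3 z"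
    by (rule disc_series_tail[OF q2(1)]) blast
  define b where "b = c 2"
  define B where "B = cmod b"
  have expand: "q z / z - c 1 = 1 / z + b * z + z\<^sup>2 * q3 z" if "z \<in> \<D> - {0}" for z
    using that q1(2)[of z] q2(2)[of z] q3(2)[of z] c0
    by (simp add: field_simps b_def power2_eq_square numeral_2_eq_2)
  have main: "S r \<le> 1 / r\<^sup>2" if r: "0 < r" "r < 1" for r
  proof -
    have "bounded (q3 ` cball 0 r)"
      using r by (intro compact_imp_bounded compact_continuous_image compact_cball
        continuous_on_subset[OF holomorphic_on_imp_continuous_on[OF disc_series_holomorphic[OF q3(1)]]]) auto
    then obtain C where C: "C > 0" "\<And>z. z \<in> cball 0 r \<Longrightarrow> cmod (q3 z) \<le> C"
      by (auto simp: bounded_pos)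
    define K where "K = C + B * (B + C)"
    have B: "B \<ge> 0" by (simp add: B_def)
    have step: "(1 - B\<^sup>2 * \<rho> ^ 4) * (S r - S \<rho> - 1 / r\<^sup>2) \<le> 2 * K * \<rho> + K\<^sup>2 * \<rho> ^ 4 + B\<^sup>2 * \<rho>\<^sup>2"
      if \<rho>: "0 < \<rho>" "\<rho> < r" "\<rho> < 1 / (2 * (B + C))" for \<rho>
    proof -
      define P where "P = (\<lambda>\<zeta>. q (exp \<zeta>) / exp \<zeta> - c 1)"
      define \<alpha> \<beta> where "\<alpha> = Complex (ln \<rho>) 0" and "\<beta> = Complex (ln r) (2 * pi)"
      define \<gamma> where "\<gamma> = of_real (\<rho>\<^sup>2) * b"
      define R where "R = 1 / \<rho> + K * \<rho>\<^sup>2"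
      have small: "2 * \<rho> * (B + C) < 1"
        using \<rho>(3) B C(1) by (simp add: field_simps)
      have in_box: "exp \<zeta> \<in> \<D> - {0}" "\<rho> \<le> cmod (exp \<zeta>)" "cmod (exp \<zeta>) \<le> r" "0 < Im \<zeta>" "Im \<zeta> < 2 * pi"
        if "\<zeta> \<in> box \<alpha> \<beta>" for \<zeta>
      proof -
        have re: "ln \<rho> < Re \<zeta>" "Re \<zeta> < ln r" and im: "0 < Im \<zeta>" "Im \<zeta> < 2 * pi"
          using that by (auto simp: in_box_complex_iff \<alpha>_def \<beta>_def)
        have "exp (ln \<rho>) \<le> exp (Re \<zeta>)" "exp (Re \<zeta>) \<le> exp (ln r)"
          using re by simp_all
        then show "\<rho> \<le> cmod (exp \<zeta>)" "cmod (exp \<zeta>) \<le> r"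
          using \<rho>(1) r(1) by simp_all
        then have "cmod (exp \<zeta>) < 1"
          using r by linarith
        then show "exp \<zeta> \<in> \<D> - {0}"
          by simp
        show "0 < Im \<zeta>" "Im \<zeta> < 2 * pi" by fact+
      qed
      have "cmod \<gamma> = B * \<rho>\<^sup>2"
        unfolding \<gamma>_def B_def norm_mult norm_of_real by simp
      then have \<gamma>2: "(cmod \<gamma>)\<^sup>2 = B\<^sup>2 * \<rho> ^ 4"
        by (simp add: power_mult_distrib flip: power_mult)
      have "cmod \<gamma> < 1"
      proof -
        have "B * \<rho>\<^sup>2 = \<rho> * B * \<rho>" by (simp add: power2_eq_square)
        also have "\<dots> \<le> \<rho> * B * 1"
          using \<rho> r B by (intro mult_left_mono) auto
        also have "\<dots> < 1"
        proof -
          have "\<rho> * B \<le> \<rho> * (B + C)" "0 \<le> \<rho> * (B + C)"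
            using B C(1) \<rho>(1) by simp_all
          then show ?thesis
            using small by simp
        qed
        finally show ?thesis using \<open>cmod \<gamma> = B * \<rho>\<^sup>2\<close> by simp
      qed
      have "R \<ge> 0"
        using \<rho>(1) B C(1) by (simp add: R_def K_def)
      have ph: "P holomorphic_on {\<zeta>. Re \<zeta> < 0}"
        and lower: "pi * (exp (- 2 * ln \<rho>) - exp (- 2 * ln r) +
             (\<Sum>n<N. (real n + 1) * (cmod (c (n + 2)))\<^sup>2 * (exp (ln r) ^ (2 * n + 2) - exp (ln \<rho>) ^ (2 * n + 2))))
         \<le> integral {ln \<rho>..ln r} (\<lambda>x. integral {0..2*pi} (\<lambda>y. (cmod (deriv P (Complex x y)))\<^sup>2))"
        unfolding P_def
        by (rule area_of_annulus_image[OF q c0, of "ln \<rho>" "ln r"]; use \<rho> r in simp)+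
      have lower': "pi * (1 / \<rho>\<^sup>2 - 1 / r\<^sup>2 + S r - S \<rho>)
         \<le> integral {ln \<rho>..ln r} (\<lambda>x. integral {0..2*pi} (\<lambda>y. (cmod (deriv P (Complex x y)))\<^sup>2))"
      proof -
        have "exp (- 2 * ln x) = 1 / x\<^sup>2" if "x > 0" for x :: real
          using that by (simp add: exp_minus exp_double divide_inverse)
        then have "exp (- 2 * ln \<rho>) = 1 / \<rho>\<^sup>2" "exp (- 2 * ln r) = 1 / r\<^sup>2"
          using \<rho>(1) r(1) by blast+
        moreover have "(\<Sum>n<N. (real n + 1) * (cmod (c (n + 2)))\<^sup>2 *
            (exp (ln r) ^ (2 * n + 2) - exp (ln \<rho>) ^ (2 * n + 2))) = S r - S \<rho>"
          using \<rho>(1) r(1) by (simp only: S_def exp_ln right_diff_distrib sum_subtractf)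
        ultimately show ?thesis
          using lower by (simp only: add_diff_eq)
      qed
      have upper: "(1 - (cmod \<gamma>)\<^sup>2) *
          integral {ln \<rho>..ln r} (\<lambda>x. integral {0..2*pi} (\<lambda>y. (cmod (deriv P (Complex x y)))\<^sup>2)) \<le> pi * R\<^sup>2"
      proof -
        \<comment> \<open>the open rectangle has height \<open>2 * \<pi>\<close>, so \<open>exp\<close> is injective on it\<close>
        have "inj_on P (box \<alpha> \<beta>)"
        proof (rule inj_onI)
          fix x y assume xy: "x \<in> box \<alpha> \<beta>" "y \<in> box \<alpha> \<beta>" "P x = P y"
          then have "exp x = exp y"
            using inj_onD[OF inj, of "exp x" "exp y"] in_box by (simp add: P_def)
          moreover have "\<bar>Im x - Im y\<bar> < 2 * pi"
            using in_box(4,5)[OF xy(1)] in_box(4,5)[OF xy(2)] by linarith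
          ultimately show "x = y"
            by (rule exp_complex_eqI[rotated])
        qed
        moreover have "cmod (P \<zeta> - \<gamma> * cnj (P \<zeta>)) \<le> R" if "\<zeta> \<in> box \<alpha> \<beta>" for \<zeta>
        proof -
          let ?z = "exp \<zeta>"
          note z = in_box[OF that]
          have "cmod (?z\<^sup>2 * q3 ?z) \<le> C * (cmod ?z)\<^sup>2"
            using C(2)[of ?z] z(3) by (simp add: norm_mult norm_power mult.commute mult_left_mono)
          moreover have "cmod ?z \<le> 1"
            using z(3) r by linarith
          moreover have "2 * \<rho> * (cmod b + C) \<le> 1"
            using small by (simp add: B_def)
          moreover have "P \<zeta> = 1 / ?z + b * ?z + ?z\<^sup>2 * q3 ?z"
            using expand[OF z(1)] by (simp only: P_def)
          ultimately show ?thesis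
            unfolding \<gamma>_def R_def K_def B_def
            using nearly_circular_bound[OF \<rho>(1) z(2), of "?z\<^sup>2 * q3 ?z" C b] by (simp only:)
        qed
        moreover have "cbox \<alpha> \<beta> \<subseteq> {\<zeta>. Re \<zeta> < 0}"
        proof -
          have "ln r < 0"
            using r by simp
          then show ?thesis
            by (auto simp: in_cbox_complex_iff \<alpha>_def \<beta>_def)
        qed
        ultimately show ?thesis
          using area_inequality[OF ph open_halfspace_Re_lt, of \<alpha> \<beta> \<gamma> R] \<open>cmod \<gamma> < 1\<close> \<open>R \<ge> 0\<close>
          by (simp add: \<alpha>_def \<beta>_def)
      qed
      have "1 - (cmod \<gamma>)\<^sup>2 \<ge> 0"
        using \<open>cmod \<gamma> < 1\<close> by (simp add: power_le_one)
      then have "(1 - (cmod \<gamma>)\<^sup>2) * (pi * (1 / \<rho>\<^sup>2 - 1 / r\<^sup>2 + S r - S \<rho>)) \<le> pi * R\<^sup>2"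
        by (rule order_trans[OF mult_left_mono[OF lower'] upper])
      then have "pi * ((1 - B\<^sup>2 * \<rho> ^ 4) * (1 / \<rho>\<^sup>2 - 1 / r\<^sup>2 + S r - S \<rho>)) \<le> pi * R\<^sup>2"
        by (simp only: \<gamma>2 mult.left_commute)
      then have "(1 - B\<^sup>2 * \<rho> ^ 4) * (1 / \<rho>\<^sup>2 - 1 / r\<^sup>2 + S r - S \<rho>) \<le> R\<^sup>2"
        by (simp add: mult_le_cancel_left_pos)
      moreover have "(1 - B\<^sup>2 * \<rho> ^ 4) * (1 / \<rho>\<^sup>2 - 1 / r\<^sup>2 + S r - S \<rho>) =
          (1 - B\<^sup>2 * \<rho> ^ 4) * (S r - S \<rho> - 1 / r\<^sup>2) + 1 / \<rho>\<^sup>2 - B\<^sup>2 * \<rho>\<^sup>2"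
        using \<rho>(1) by (simp add: algebra_simps power2_eq_square power4_eq_xxxx)
      moreover have "R\<^sup>2 = 1 / \<rho>\<^sup>2 + 2 * K * \<rho> + K\<^sup>2 * \<rho> ^ 4"
        using \<rho>(1) by (simp add: R_def power2_eq_square power4_eq_xxxx field_simps)
      ultimately show ?thesis
        by linarith
    qed
    \<comment> \<open>let \<open>\<rho>\<close> tend to 0 in \<open>step\<close>; the right-hand side tends to 0\<close>
    define \<delta> where "\<delta> = min r (1 / (2 * (B + C)))"
    have "\<delta> > 0"
      using r B C(1) by (simp add: \<delta>_def)
    have "(1 - B\<^sup>2 * 0 ^ 4) * (S r - S 0 - 1 / r\<^sup>2) \<le> 2 * K * 0 + K\<^sup>2 * 0 ^ 4 + B\<^sup>2 * 0\<^sup>2"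
    proof (rule tendsto_le[of "at_right (0::real)"])
      show "((\<lambda>\<rho>. (1 - B\<^sup>2 * \<rho> ^ 4) * (S r - S \<rho> - 1 / r\<^sup>2)) \<longlongrightarrow>
          (1 - B\<^sup>2 * 0 ^ 4) * (S r - S 0 - 1 / r\<^sup>2)) (at_right 0)"
        by (intro tendsto_intros contS)
      show "((\<lambda>\<rho>. 2 * K * \<rho> + K\<^sup>2 * \<rho> ^ 4 + B\<^sup>2 * \<rho>\<^sup>2) \<longlongrightarrow> 2 * K * 0 + K\<^sup>2 * 0 ^ 4 + B\<^sup>2 * 0\<^sup>2) (at_right 0)"
        by (intro tendsto_intros)
      have "eventually (\<lambda>\<rho>. \<rho> \<in> {0<..<\<delta>}) (at_right 0)"
        using \<open>\<delta> > 0\<close> by (rule eventually_at_right_real)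
      then show "eventually (\<lambda>\<rho>. (1 - B\<^sup>2 * \<rho> ^ 4) * (S r - S \<rho> - 1 / r\<^sup>2)
          \<le> 2 * K * \<rho> + K\<^sup>2 * \<rho> ^ 4 + B\<^sup>2 * \<rho>\<^sup>2) (at_right 0)"
        by eventually_elim (rule step, auto simp: \<delta>_def)
    qed simp
    then show ?thesis
      using S0 by simp
  qed
  have "S 1 \<le> 1 / 1\<^sup>2"
  proof (rule tendsto_le[of "at_left (1::real)"])
    show "((\<lambda>r. 1 / r\<^sup>2) \<longlongrightarrow> 1 / 1\<^sup>2) (at_left (1::real))"
      by (intro tendsto_intros) auto
    show "(S \<longlongrightarrow> S 1) (at_left 1)"
      by (rule contS)
    have "eventually (\<lambda>r. r \<in> {0<..<1}) (at_left (1::real))"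
      by (rule eventually_at_left_real) simp
    then show "eventually (\<lambda>r. S r \<le> 1 / r\<^sup>2) (at_left 1)"
      by eventually_elim (rule main, auto)
  qed simp
  then show ?thesis
    by (simp add: S_def)
qed

section \<open>Univalent analytic functions with integer coefficients\<close>

lemma norm_Ints_ge_1:
  assumes "x \<in> \<int>" "x \<noteq> (0::complex)"
  shows "1 \<le> cmod x"
proof -
  obtain k where "x = of_int k"
    using assms(1) by (rule Ints_cases)
  moreover from this have "1 \<le> \<bar>k\<bar>"
    using assms(2) by auto
  then have "1 \<le> real_of_int \<bar>k\<bar>"
    by linarith
  ultimately show ?thesis
    by simp
qed

lemma quadratic_root_in_unit_interval:
  fixes m l :: real
  assumes "1 + m + l < 0"
  obtains x where "0 < x" "x < 1" "1 + m * x + l * x\<^sup>2 = 0"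
proof -
  have "\<exists>x\<ge>0. x \<le> 1 \<and> 1 + m * x + l * x\<^sup>2 = 0"
    by (rule IVT2') (use assms in \<open>auto intro!: continuous_intros\<close>)
  then obtain x where "0 \<le> x" "x \<le> 1" "1 + m * x + l * x\<^sup>2 = 0"
    by blast
  moreover from this have "x \<noteq> 0" "x \<noteq> 1"
    using assms by auto
  ultimately show ?thesis
    using that[of x] by simp
qed

text \<open>The polynomial is 1 at 0, so a negative value at 1 or at -1 would force a real zero strictly in
between. These two values are \<open>1 + m + l\<close> and \<open>1 - m + l\<close>.\<close>

lemma zero_free_quadratic:
  fixes m l :: int
  assumes nz: "\<And>z. z \<in> \<D> \<Longrightarrow> 1 + of_int m * z + of_int l * z\<^sup>2 \<noteq> (0::complex)"
  shows "\<bar>m\<bar> \<le> 1 + l"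
proof -
  \<comment> \<open>\<open>e\<close> is the sign that selects the end point 1 or -1\<close>
  have "0 \<le> 1 + e * m + l" if "\<bar>e\<bar> = 1" for e
  proof (rule ccontr)
    assume "\<not> 0 \<le> 1 + e * m + l"
    then have "1 + real_of_int (e * m) + real_of_int l < 0"
      by linarith
    then obtain x where x: "0 < x" "x < 1" "1 + real_of_int (e * m) * x + real_of_int l * x\<^sup>2 = 0"
      by (rule quadratic_root_in_unit_interval)
    have "1 + of_int m * of_real (e * x) + of_int l * (of_real (e * x))\<^sup>2 =
        complex_of_real (1 + real_of_int (e * m) * x + real_of_int l * x\<^sup>2)"
      using that by (auto simp: abs_if split: if_splits)
    moreover have "complex_of_real (e * x) \<in> \<D>"
      using x that by (auto simp: abs_if split: if_splits)
    ultimately show False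
      using nz x(3) by (metis of_real_0)
  qed
  from this[of 1] this[of "-1"] show ?thesis
    by simp
qed

text \<open>Friedman's theorem. The reciprocal \<open>1 / h z = q z / z\<close> is injective on the punctured disc and \<open>q\<close>
has integer coefficients, so the area theorem kills all coefficients of \<open>q\<close> beyond the second and
leaves \<open>q z = 1 + m * z + l * z^2\<close> with \<open>|l| \<le> 1\<close>. As \<open>q = z / h\<close> has no zeros,
\<open>|m| \<le> 1 + l\<close>; the solutions number \<open>1 + 3 + 5\<close> for \<open>l = -1, 0, 1\<close>.\<close>

lemma integer_univalent_functions:
  assumes h: "disc_series a h" "a 0 = 0" "a 1 = 1" "\<And>n. a n \<in> \<int>"
    and inj: "inj_on h \<D>"
  shows "\<exists>F\<in>S_Z. \<forall>z\<in>\<D>. h z = F z"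
proof -
  obtain p where p: "disc_series (\<lambda>n. a (Suc n)) p" "\<And>z. z \<in> \<D> \<Longrightarrow> h z = a 0 + z * p z"
    by (rule disc_series_tail[OF h(1)]) blast
  have hp: "h z = z * p z" if "z \<in> \<D>" for z
    using p(2)[OF that] h(2) by simp
  have p0: "p 0 = 1"
    using disc_series_at_0[OF p(1)] h(3) by simp
  \<comment> \<open>by injectivity, \<open>h\<close> vanishes only at 0\<close>
  have pnz: "p z \<noteq> 0" if "z \<in> \<D>" for z
  proof
    assume "p z = 0"
    then have "h z = h 0"
      using hp[OF that] hp[of 0] by simp
    then have "z = 0"
      using inj that by (auto dest: inj_onD)
    with \<open>p z = 0\<close> p0 show False by simp
  qed
  define q where "q z = 1 / p z" for z
  have "q holomorphic_on \<D>"
    unfolding q_def by (intro holomorphic_intros disc_series_holomorphic[OF p(1)] pnz)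
  then obtain c where c: "disc_series c q"
    using holomorphic_disc_series by blast
  have c0: "c 0 = 1"
    using disc_series_at_0[OF c] p0 by (simp add: q_def)
  have "disc_series (\<lambda>n. if n = 0 then 1 else 0) (\<lambda>z. q z * p z)"
    unfolding disc_series_def
  proof
    fix z :: complex assume z: "z \<in> \<D>"
    show "(\<lambda>n. (if n = 0 then 1 else 0) * z ^ n) sums (q z * p z)"
      using sums_finite[of "{0}" "\<lambda>n. (if n = 0 then 1 else 0) * z ^ n"] pnz[OF z]
      by (simp add: q_def)
  qed
  then have c_Ints: "c n \<in> \<int>" for n
    by (rule disc_series_quotient_Ints[OF p(1) c]) (use h(3,4) in auto)
  have "inj_on (\<lambda>z. q z / z) (\<D> - {0})"
  proof (rule inj_onI)
    fix z w assume *: "z \<in> \<D> - {0}" "w \<in> \<D> - {0}" "q z / z = q w / w"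
    have "q z / z = 1 / h z" "q w / w = 1 / h w"
      using *(1,2) hp[of z] hp[of w] by (simp_all add: q_def)
    then have "h z = h w"
      using *(3) by simp
    then show "z = w"
      using inj *(1,2) by (auto dest: inj_onD)
  qed
  note area = area_theorem[OF c c0 this]
  have coeff: "(real n + 1) * (cmod (c (n + 2)))\<^sup>2 \<le> 1" for n
  proof -
    have "(real n + 1) * (cmod (c (n + 2)))\<^sup>2 \<le> (\<Sum>n<Suc n. (real n + 1) * (cmod (c (n + 2)))\<^sup>2)"
      by (rule member_le_sum) auto
    then show ?thesis
      using area[of "Suc n"] by linarith
  qed
  have vanish: "c n = 0" if "n \<ge> 3" for n
  proof (rule ccontr)
    assume "c n \<noteq> 0"
    then have "1 \<le> (cmod (c n))\<^sup>2"
      using norm_Ints_ge_1[OF c_Ints] by (simp add: one_le_power)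
    moreover have "(real (n - 2) + 1) * (cmod (c n))\<^sup>2 \<le> 1"
    proof -
      have "n - 2 + 2 = n"
        using that by simp
      then show ?thesis
        using coeff[of "n - 2"] by (simp only:)
    qed
    moreover have "real (n - 2) \<ge> 1"
      using that by linarith
    ultimately show False
      using mult_mono[of 2 "real (n - 2) + 1" 1 "(cmod (c n))\<^sup>2"] by linarith
  qed
  obtain m where m: "c 1 = of_int m"
    using c_Ints[of 1] by (rule Ints_cases)
  obtain l where l: "c 2 = of_int l"
    using c_Ints[of 2] by (rule Ints_cases)
  have "\<bar>l\<bar> \<le> 1"
  proof -
    have "(cmod (c 2))\<^sup>2 \<le> 1"
      using coeff[of 0] by (simp add: numeral_2_eq_2)
    then have "cmod (c 2) \<le> 1"
      using abs_square_le_1[of "cmod (c 2)"] by simp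
    then show ?thesis
      unfolding l norm_of_int by linarith
  qed
  have q: "q z = 1 + of_int m * z + of_int l * z\<^sup>2" if "z \<in> \<D>" for z
  proof -
    have "(\<lambda>n. c n * z ^ n) sums (\<Sum>n<3. c n * z ^ n)"
      by (rule sums_finite) (auto simp: vanish)
    moreover have "(\<lambda>n. c n * z ^ n) sums q z"
      using c that by (auto simp: disc_series_def)
    ultimately have "q z = (\<Sum>n<3. c n * z ^ n)"
      by (rule sums_unique2[symmetric])
    then show ?thesis
      using c0 m l by (simp add: eval_nat_numeral)
  qed
  have hq: "h z = z / (1 + of_int m * z + of_int l * z\<^sup>2)" if "z \<in> \<D>" for z
  proof -
    have "h z = z / q z"
      using hp[OF that] by (simp add: q_def)
    then show ?thesis
      by (simp only: q[OF that])
  qed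
  have "\<bar>m\<bar> \<le> 1 + l"
    using q pnz by (intro zero_free_quadratic) (metis q_def divide_eq_0_iff zero_neq_one)
  have "(\<lambda>z. z / (1 + of_int m * z + of_int l * z\<^sup>2)) \<in> S_Z"
  proof -
    have sq: "(1 + z)\<^sup>2 = 1 + 2 * z + z\<^sup>2" "(1 - z)\<^sup>2 = 1 - 2 * z + z\<^sup>2" for z :: complex
      by (simp_all add: power2_eq_square algebra_simps)
    consider "l = -1" | "l = 0" | "l = 1"
      using \<open>\<bar>l\<bar> \<le> 1\<close> by linarith
    then show ?thesis
    proof cases
      case 1
      then have "m = 0"
        using \<open>\<bar>m\<bar> \<le> 1 + l\<close> by simp
      with 1 show ?thesis
        by (simp add: S_Z_def)
    next
      case 2
      then have "m = -1 \<or> m = 0 \<or> m = 1"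
        using \<open>\<bar>m\<bar> \<le> 1 + l\<close> by linarith
      with 2 show ?thesis
        by (elim disjE) (simp_all add: S_Z_def)
    next
      case 3
      then have "m = -2 \<or> m = -1 \<or> m = 0 \<or> m = 1 \<or> m = 2"
        using \<open>\<bar>m\<bar> \<le> 1 + l\<close> by linarith
      with 3 show ?thesis
        by (elim disjE) (simp_all add: S_Z_def sq)
    qed
  qed
  then show ?thesis
    by (rule rev_bexI) (intro ballI hq)
qed

section \<open>The co-analytic part\<close>

text \<open>Cauchy's estimate on circles of radius tending to 1.\<close>

lemma disc_series_coeff_le_1:
  assumes w: "disc_series w \<omega>" and le: "\<And>z. z \<in> \<D> \<Longrightarrow> cmod (\<omega> z) \<le> 1"
  shows "cmod (w n) \<le> 1"
proof -
  have hol: "\<omega> holomorphic_on \<D>"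
    using w by (rule disc_series_holomorphic)
  have wn: "w n = (deriv ^^ n) \<omega> 0 / fact n"
    using disc_series_unique[OF w holomorphic_disc_series[OF hol]] by simp
  have "cmod (w n) * r ^ n \<le> 1" if r: "0 < r" "r < 1" for r
  proof -
    have "\<omega> holomorphic_on cball 0 r"
      using r by (intro holomorphic_on_subset[OF hol]) auto
    then have "cmod ((deriv ^^ n) \<omega> 0) \<le> fact n * 1 / r ^ n"
      using r le by (intro Cauchy_inequality)
        (auto intro: holomorphic_on_imp_continuous_on holomorphic_on_subset)
    then show ?thesis
      using r by (simp add: wn norm_divide field_simps)
  qed
  moreover have "eventually (\<lambda>r. r \<in> {0<..<1}) (at_left (1::real))"
    by (rule eventually_at_left_real) simp
  ultimately have "eventually (\<lambda>r. cmod (w n) * r ^ n \<le> 1) (at_left (1::real))"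
    by (auto elim: eventually_mono)
  moreover have "((\<lambda>r. cmod (w n) * r ^ n) \<longlongrightarrow> cmod (w n) * 1 ^ n) (at_left (1::real))"
    by (intro tendsto_intros)
  ultimately have "cmod (w n) * 1 ^ n \<le> 1"
    by (intro tendsto_upperbound[where F = "at_left (1::real)"]) auto
  then show ?thesis by simp
qed

text \<open>The dilatation \<open>\<omega> = g' / h'\<close> maps the disc into itself. Because \<open>h'\<close> has constant term 1, the first
nonzero coefficient of \<open>\<omega>\<close> is the first nonzero coefficient \<open>(n + 1) * b (n + 1)\<close> of \<open>g'\<close>, of modulus at
least \<open>n + 1\<close> by integrality. This exceeds Cauchy's bound 1 when \<open>n \<ge> 1\<close>, and contradicts
\<open>|\<omega> 0| < 1\<close> when \<open>n = 0\<close>.\<close>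

lemma integer_coanalytic_part_vanishes:
  assumes h: "disc_series a h" "a 1 = 1"
    and g: "disc_series b g" "b 0 = 0" "\<And>n. b n \<in> \<int>"
    and less: "\<And>z. z \<in> \<D> \<Longrightarrow> cmod (deriv g z) < cmod (deriv h z)"
    and "z \<in> \<D>"
  shows "g z = 0"
proof -
  have dh: "deriv h z \<noteq> 0" if "z \<in> \<D>" for z
    using less[OF that] by auto
  define \<omega> where "\<omega> z = deriv g z / deriv h z" for z
  have "\<omega> holomorphic_on \<D>"
    unfolding \<omega>_def using dh
    by (intro holomorphic_intros holomorphic_deriv disc_series_holomorphic[OF h(1)]
        disc_series_holomorphic[OF g(1)]) auto
  then obtain w where w: "disc_series w \<omega>"
    using holomorphic_disc_series by blast
  have lt: "cmod (\<omega> z) < 1" if "z \<in> \<D>" for z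
    using less[OF that] by (simp add: \<omega>_def norm_divide divide_less_eq)
  have prod: "disc_series (\<lambda>n. of_nat (Suc n) * b (Suc n)) (\<lambda>z. \<omega> z * deriv h z)"
    by (rule disc_series_cong[OF disc_series_deriv[OF g(1)]]) (use dh in \<open>simp add: \<omega>_def\<close>)
  have conv: "of_nat (Suc n) * b (Suc n) =
      (\<Sum>i\<le>n. w i * (of_nat (Suc (n - i)) * a (Suc (n - i))))" for n
    using fun_cong[OF disc_series_unique[OF prod disc_series_mult[OF w disc_series_deriv[OF h(1)]]]] .
  have w0: "w n = 0" for n
  proof (induction n rule: less_induct)
    case (less n)
    have "of_nat (Suc n) * b (Suc n) = (\<Sum>i<n. w i * (of_nat (Suc (n - i)) * a (Suc (n - i)))) + w n"
      unfolding conv lessThan_Suc_atMost[symmetric] sum.lessThan_Suc using h(2) by simp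
    then have bw: "of_nat (Suc n) * b (Suc n) = w n"
      using less by simp
    show ?case
    proof (rule ccontr)
      assume "w n \<noteq> 0"
      then have "b (Suc n) \<noteq> 0"
        using bw by auto
      then have "1 \<le> cmod (b (Suc n))"
        using norm_Ints_ge_1 g(3) by blast
      moreover have "cmod (w n) = real (Suc n) * cmod (b (Suc n))"
        by (simp only: bw[symmetric] norm_mult norm_of_nat)
      ultimately have big: "real (Suc n) \<le> cmod (w n)"
        using mult_left_mono[of 1 "cmod (b (Suc n))" "real (Suc n)"] by simp
      show False
      proof (cases n)
        case 0
        then show False
          using big lt[of 0] disc_series_at_0[OF w] by simp
      next
        case (Suc k)
        then show False
          using big disc_series_coeff_le_1[OF w less_imp_le[OF lt], of n] by simp
      qed
    qed
  qed
  have "b n = 0" for n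
  proof (cases n)
    case (Suc k)
    then show ?thesis
      using conv[of k] w0 by (simp del: of_nat_Suc)
  qed (simp add: g(2))
  then have "(\<lambda>n. 0) sums g z"
    using g(1) \<open>z \<in> \<D>\<close> by (simp add: disc_series_def)
  then show ?thesis
    using sums_unique2 sums_zero by blast
qed

text \<open>The derivative of \<open>p\<close> is complex linear and that of \<open>cnj \<circ> q\<close> is antilinear; a map that is both
is 0.\<close>

lemma holomorphic_eq_cnj_imp_deriv_0:
  assumes "p holomorphic_on S" "q holomorphic_on S" "open S"
    and eq: "\<And>z. z \<in> S \<Longrightarrow> p z = cnj (q z)" and z: "z \<in> S"
  shows "deriv p z = 0" "deriv q z = 0"
proof -
  have dp: "(p has_derivative (*) (deriv p z)) (at z)"
    using holomorphic_derivI[OF assms(1,3) z] by (simp add: has_field_derivative_def)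
  have "(q has_derivative (*) (deriv q z)) (at z)"
    using holomorphic_derivI[OF assms(2,3) z] by (simp add: has_field_derivative_def)
  then have "((\<lambda>z. cnj (q z)) has_derivative (\<lambda>u. cnj (deriv q z * u))) (at z)"
    by (rule has_derivative_cnj)
  then have "(p has_derivative (\<lambda>u. cnj (deriv q z * u))) (at z)"
    by (rule has_derivative_transform_within_open[OF _ assms(3) z]) (simp add: eq)
  then have "(*) (deriv p z) = (\<lambda>u. cnj (deriv q z * u))"
    using dp has_derivative_unique by blast
  from fun_cong[OF this, of 1] fun_cong[OF this, of \<i>]
  show "deriv p z = 0" "deriv q z = 0"
    by (simp_all add: complex_eq_iff)
qed

text \<open>Transfers the Jacobian condition, which \<open>S_H\<close> asserts of some decomposition, to any other one.\<close>

lemma decomposition_derivs_unique: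
  assumes "decomposes_as f h g" "decomposes_as f h' g'" "z \<in> \<D>"
  shows "deriv h z = deriv h' z" "deriv g z = deriv g' z"
proof -
  have hol: "h holomorphic_on \<D>" "g holomorphic_on \<D>" "h' holomorphic_on \<D>" "g' holomorphic_on \<D>"
    and f: "\<And>z. z \<in> \<D> \<Longrightarrow> f z = h z + cnj (g z)" "\<And>z. z \<in> \<D> \<Longrightarrow> f z = h' z + cnj (g' z)"
    using assms by (auto simp: decomposes_as_def)
  have diffs: "k field_differentiable at z" if "k holomorphic_on \<D>" for k
    using that assms(3) by (simp add: holomorphic_on_imp_differentiable_at)
  have "h z - h' z = cnj (g' z - g z)" if "z \<in> \<D>" for z
    using f[OF that] by (simp add: algebra_simps)
  then have "deriv (\<lambda>z. h z - h' z) z = 0" "deriv (\<lambda>z. g' z - g z) z = 0"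
    by (rule holomorphic_eq_cnj_imp_deriv_0[OF holomorphic_on_diff[OF hol(1,3)]
        holomorphic_on_diff[OF hol(4,2)] open_ball _ assms(3)]; simp)+
  then show "deriv h z = deriv h' z" "deriv g z = deriv g' z"
    using diffs hol by simp_all
qed

theorem theorem1:
  fixes f h g :: "complex \<Rightarrow> complex" and a b :: "nat \<Rightarrow> complex"
  assumes "f \<in> S_H"
    and "decomposes_as f h g"
    and "normalized_expansion h g a b"
    and "\<forall>n\<ge>2. a n \<in> \<int>"
    and "\<forall>n\<ge>1. b n \<in> \<int>"
  shows "\<exists>F\<in>S_Z. \<forall>z\<in>\<D>. f z = F z"
proof -
  \<comment> \<open>the normalization prescribes the coefficients \<open>0, 1\<close> of \<open>h\<close> and \<open>0\<close> of \<open>g\<close> that precede \<open>a 2\<close> and \<open>b 1\<close>\<close>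
  define \<alpha> where "\<alpha> n = (if n = 0 then 0 else if n = 1 then 1 else a n)" for n
  define \<beta> where "\<beta> n = (if n = 0 then 0 else b n)" for n
  have \<alpha>: "disc_series \<alpha> h" and \<beta>: "disc_series \<beta> g"
    unfolding disc_series_def
  proof (safe)
    fix z :: complex assume "z \<in> \<D>"
    then have "(\<lambda>n. \<alpha> (n + 2) * z ^ (n + 2)) sums (h z - z)" "(\<lambda>n. \<beta> (n + 1) * z ^ (n + 1)) sums g z"
      using assms(3) by (simp_all add: normalized_expansion_def \<alpha>_def \<beta>_def)
    then show "(\<lambda>n. \<alpha> n * z ^ n) sums h z" "(\<lambda>n. \<beta> n * z ^ n) sums g z"
      using sums_iff_shift[of "\<lambda>n. \<alpha> n * z ^ n" 2 "h z - z"] sums_iff_shift[of "\<lambda>n. \<beta> n * z ^ n" 1 "g z"]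
      by (simp_all add: \<alpha>_def \<beta>_def numeral_2_eq_2)
  qed
  obtain h' g' where hg': "decomposes_as f h' g'" and jac: "\<And>z. z \<in> \<D> \<Longrightarrow> jacobian h' g' z > 0"
    and inj: "inj_on f \<D>"
    using assms(1) by (auto simp: S_H_def)
  have less: "cmod (deriv g z) < cmod (deriv h z)" if "z \<in> \<D>" for z
    using jac[OF that] decomposition_derivs_unique[OF assms(2) hg' that]
    by (simp add: jacobian_def power2_less_imp_less)
  have "g z = 0" if "z \<in> \<D>" for z
    by (rule integer_coanalytic_part_vanishes[OF \<alpha> _ \<beta> _ _ less that])
      (use assms(5) in \<open>auto simp: \<alpha>_def \<beta>_def\<close>)
  then have fh: "f z = h z" if "z \<in> \<D>" for z
    using assms(2) that by (simp add: decomposes_as_def)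
  then have "inj_on h \<D>"
    using inj inj_on_cong[of \<D> f h] by blast
  then have "\<exists>F\<in>S_Z. \<forall>z\<in>\<D>. h z = F z"
    by (rule integer_univalent_functions[OF \<alpha>, rotated -1]) (use assms(4) in \<open>auto simp: \<alpha>_def\<close>)
  then show ?thesis
    using fh by simp
qed

end
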